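(* Let $d\ge 2$ be an integer, let $\varepsilon>0$, and put $n=\lceil 1/\varepsilon\rceil$. Suppose it is known in advance that the (otherwise unknown) collection of preference sets $\{A_{ij}\}_{i,j\in\{1,\ldots,d\}}$ on the simplex $A$ has the following property: each $A_{ij}$ is the intersection of $A$ and a closed half-space with boundary hyperplane parallel to the facet $F_j$, and satisfies $F_j\subset A_{ij}$. Then an $\varepsilon$-fair division point can be found in minimal mode using at most $$(d-1)\left\lceil \log_{\frac{d}{d-1}} n\right\rceil$$ queries. That is, there is an adaptive algorithm in minimal mode which, for every collection with this property (and all admissible answers to its queries), makes at most this many queries and outputs an $\varepsilon$-fair division point.
   Context: Let $A$ be a $(d-1)$-dimensional regular simplex with edges of Euclidean length $1$ in $\mathbb{R}^{d-1}$, with vertices $v_1,\ldots,v_d$. Each $x\in A$ is written in barycentric coordinates as $x=[\alpha_1,\ldots,\alpha_d]=\sum_i\alpha_i v_i$ with $\alpha_i\ge 0$, $\sum_i\alpha_i=1$. The facet $F_j$ is the convex hull of $\{v_k\}_{k\ne j}$, so hyperplanes parallel to $F_j$ are those of the form $\{\alpha_j=\text{const}\}$. The metric is $\operatorname{dist}([\alpha_1,\ldots,\alpha_d],[\alpha'_1,\ldots,\alpha'_d])=\max_i|\alpha_i-\alpha'_i|$ (extended to $\mathbb{R}^{d-1}$ by the same formula in affine barycentric coordinates). Preference sets: a collection $\{A_{ij}\}_{i,j\in\{1,\ldots,d\}}$ of closed subsets of $A$ such that for each $i$ (an agent) $\bigcup_{j=1}^d A_{ij}=A$. For $\varepsilon\ge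 0$ put $A^{\varepsilon}_{ij}=\{x\in\mathbb{R}^{d-1}:\operatorname{dist}(x,A_{ij})\le\varepsilon\}$. A point $x\in A$ is an $\varepsilon$-fair division point if there is a permutation $\sigma$ of $\{1,\ldots,d\}$ with $x\in A^{\varepsilon}_{i\sigma(i)}$ for all $i$. Query model: the sets $A_{ij}$ are fixed but unknown to the algorithm. A query in minimal mode consists of choosing an index $i\in\{1,\ldots,d\}$ and a point $x\in A$; the answer is some index $j$ such that $x\in A_{ij}$ (if several such $j$ exist, any one of them may be returned). Each query may depend on the previous answers, and after its queries the algorithm outputs a point of $A$ depending only on $d$, $\varepsilon$ and the answers received. Only the number of queries is counted. *)

theory Defs
  imports "HOL-Analysis.Analysis"
begin

text \<open>
  Agents, pieces and vertices are indexed by \<open>{1..d}\<close>; values of \<open>v\<close>, of a collection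
  \<open>A i j\<close>, etc. at other indices are irrelevant.
\<close>

text \<open>Pairwise unit distances already force the vertices to be affinely independent.\<close>

definition regular_unit_simplex :: "nat \<Rightarrow> (nat \<Rightarrow> 'a::euclidean_space) \<Rightarrow> bool" where
  "regular_unit_simplex d v \<longleftrightarrow>
     (\<forall>i\<in>{1..d}. \<forall>j\<in>{1..d}. i \<noteq> j \<longrightarrow> dist (v i) (v j) = 1)"

definition simplex_of :: "nat \<Rightarrow> (nat \<Rightarrow> 'a::euclidean_space) \<Rightarrow> 'a set" where
  "simplex_of d v = convex hull (v ` {1..d})"

definition facet :: "nat \<Rightarrow> (nat \<Rightarrow> 'a::euclidean_space) \<Rightarrow> nat \<Rightarrow> 'a set" where
  "facet d v j = convex hull (v ` ({1..d} - {j}))"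

text \<open>
  Affine barycentric coordinates, defined on the whole space (coordinates may be negative).
  They exist and are unique when \<open>v 1, \<dots>, v d\<close> are affinely independent and the
  ambient dimension is \<open>d - 1\<close>; the first conjunct only fixes the values at unused indices.
\<close>

definition bary :: "nat \<Rightarrow> (nat \<Rightarrow> 'a::euclidean_space) \<Rightarrow> 'a \<Rightarrow> nat \<Rightarrow> real" where
  "bary d v x = (THE \<alpha>. (\<forall>i. i \<notin> {1..d} \<longrightarrow> \<alpha> i = 0) \<and>
     (\<Sum>i=1..d. \<alpha> i) = 1 \<and> (\<Sum>i=1..d. \<alpha> i *\<^sub>R v i) = x)"

definition bary_dist :: "nat \<Rightarrow> (nat \<Rightarrow> 'a::euclidean_space) \<Rightarrow> 'a \<Rightarrow> 'a \<Rightarrow> real" where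
  "bary_dist d v x y = Max ((\<lambda>i. \<bar>bary d v x i - bary d v y i\<bar>) ` {1..d})"

text \<open>
  The set of points at \<open>bary_dist\<close>-distance at most \<open>\<epsilon>\<close> from \<open>S\<close>. The distance to the
  empty set is taken to be infinite, so its neighbourhood is empty (the library's
  \<open>infdist\<close> would use \<open>0\<close>).
\<close>

definition nbhd :: "nat \<Rightarrow> (nat \<Rightarrow> 'a::euclidean_space) \<Rightarrow> real \<Rightarrow> 'a set \<Rightarrow> 'a set" where
  "nbhd d v \<epsilon> S = {x. S \<noteq> {} \<and> (INF y\<in>S. bary_dist d v x y) \<le> \<epsilon>}"

definition preference_sets ::
    "nat \<Rightarrow> (nat \<Rightarrow> 'a::euclidean_space) \<Rightarrow> (nat \<Rightarrow> nat \<Rightarrow> 'a set) \<Rightarrow> bool" where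
  "preference_sets d v A \<longleftrightarrow>
     (\<forall>i\<in>{1..d}. \<forall>j\<in>{1..d}. closed (A i j) \<and> A i j \<subseteq> simplex_of d v) \<and>
     (\<forall>i\<in>{1..d}. (\<Union>j\<in>{1..d}. A i j) = simplex_of d v)"

definition half_space_preferences ::
    "nat \<Rightarrow> (nat \<Rightarrow> 'a::euclidean_space) \<Rightarrow> (nat \<Rightarrow> nat \<Rightarrow> 'a set) \<Rightarrow> bool" where
  "half_space_preferences d v A \<longleftrightarrow>
     (\<forall>i\<in>{1..d}. \<forall>j\<in>{1..d}.
        (\<exists>a b. a \<noteq> 0 \<and> affine_parallel {x. a \<bullet> x = b} (affine hull (facet d v j)) \<and>
               A i j = simplex_of d v \<inter> {x. a \<bullet> x \<le> b}) \<and>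
        facet d v j \<subseteq> A i j)"

definition fair_division_point ::
    "nat \<Rightarrow> (nat \<Rightarrow> 'a::euclidean_space) \<Rightarrow> real \<Rightarrow> (nat \<Rightarrow> nat \<Rightarrow> 'a set) \<Rightarrow> 'a \<Rightarrow> bool" where
  "fair_division_point d v \<epsilon> A x \<longleftrightarrow>
     x \<in> simplex_of d v \<and>
     (\<exists>\<sigma>. \<sigma> permutes {1..d} \<and> (\<forall>i\<in>{1..d}. x \<in> nbhd d v \<epsilon> (A i (\<sigma> i))))"

text \<open>
  A deterministic adaptive algorithm is a decision tree: it either outputs a point, or asks
  agent \<open>i\<close> about the point \<open>x\<close> and continues with a subtree determined by the answer.
\<close>

datatype 'a algorithm =
    Output 'a
  | Query nat 'a "nat \<Rightarrow> 'a algorithm"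

primrec valid_algorithm ::
    "nat \<Rightarrow> (nat \<Rightarrow> 'a::euclidean_space) \<Rightarrow> 'a algorithm \<Rightarrow> bool" where
  "valid_algorithm d v (Output x) \<longleftrightarrow> x \<in> simplex_of d v"
| "valid_algorithm d v (Query i x cont) \<longleftrightarrow>
     i \<in> {1..d} \<and> x \<in> simplex_of d v \<and> (\<forall>j\<in>{1..d}. valid_algorithm d v (cont j))"

text \<open>
  \<open>minimal_run d A T y k\<close>: for some admissible sequence of answers in minimal mode, \<open>T\<close>
  outputs \<open>y\<close> after \<open>k\<close> queries. If the sets cover the simplex, every query of a valid
  algorithm has an admissible answer, so no execution gets stuck.
\<close>

inductive minimal_run ::
    "nat \<Rightarrow> (nat \<Rightarrow> nat \<Rightarrow> 'a set) \<Rightarrow> 'a algorithm \<Rightarrow> 'a \<Rightarrow> nat \<Rightarrow> bool"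
  for d :: nat and A :: "nat \<Rightarrow> nat \<Rightarrow> 'a set" where
  run_output: "minimal_run d A (Output y) y 0"
| run_query: "j \<in> {1..d} \<Longrightarrow> x \<in> A i j \<Longrightarrow> minimal_run d A (cont j) y k \<Longrightarrow>
    minimal_run d A (Query i x cont) y (Suc k)"

end

theory Submission imports Defs begin

text \<open>
  The preference sets are \<open>A i j = {x. x\<^sub>j \<le> t i j}\<close> with unknown thresholds \<open>t i j \<ge> 0\<close>.
  Each of the agents \<open>1, \<dots>, d - 1\<close> is asked repeatedly about the point obtained from his known
  lower bounds \<open>l i j \<le> t i j\<close> by spreading their slack \<open>1 - (\<Sum>j. l i j)\<close> evenly over the
  coordinates. The answer \<open>j\<close> raises the \<open>j\<close>-th bound to that of the point, which multiplies the
  slack by \<open>(d - 1) / d\<close>; after the allotted number of queries it is at most \<open>\<epsilon>\<close>.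

  Agent \<open>d\<close> is never asked: there is a point \<open>x\<close> such that, whichever piece agent \<open>d\<close> accepts, the
  others can be matched with the remaining pieces, with \<open>x\<^sub>j \<le> p i j\<close> whenever \<open>i\<close> gets \<open>j\<close>,
  where \<open>p i\<close> is the next point that \<open>i\<close> would be asked about. Read \<open>p i j\<close> as the value of \<open>j\<close>
  for \<open>i\<close> and the coordinates of \<open>x\<close> as prices. At a minimum of
  \<open>d * (\<Sum>i<d. max\<^sub>j (p i j - x\<^sub>j)) + (d - 1) * (\<Sum>j\<le>d. x\<^sub>j)\<close>, raising the prices of all pieces demanded
  by a set \<open>S\<close> of agents gains nothing, so \<open>S\<close> demands at least \<open>d / (d - 1) * card S\<close> pieces, and
  Hall's theorem applies even after one piece is removed. All bounds are rational, so after scaling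
  the prices may be taken to be integers and the minimum exists trivially.
\<close>

section \<open>Matchings and prices\<close>

text \<open>Halmos-Vaughan induction. A nonempty proper subset \<open>S\<close> with exactly
  \<open>card S\<close> neighbours is matched first and its neighbours are withdrawn from the
  others. If there is none, every nonempty proper subset has a spare neighbour, so one pair can be
  fixed arbitrarily.\<close>

theorem hall_marriage:
  assumes "finite I" "\<And>i. i \<in> I \<Longrightarrow> finite (N i)"
    and "\<And>S. S \<subseteq> I \<Longrightarrow> card S \<le> card (\<Union>i\<in>S. N i)"
  shows "\<exists>\<sigma>. inj_on \<sigma> I \<and> (\<forall>i\<in>I. \<sigma> i \<in> N i)"
  using assms
proof (induction I arbitrary: N rule: finite_psubset_induct)
  case (psubset I)
  note fin = psubset.prems(1) and hall = psubset.prems(2)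
  show ?case
  proof (cases "\<exists>S. S \<noteq> {} \<and> S \<subset> I \<and> card (\<Union>i\<in>S. N i) = card S")
    case True
    then obtain S where S: "S \<noteq> {}" "S \<subset> I" "card (\<Union>i\<in>S. N i) = card S" by blast
    have "\<exists>\<sigma>. inj_on \<sigma> S \<and> (\<forall>i\<in>S. \<sigma> i \<in> N i)"
      using S by (intro psubset.IH fin hall) auto
    then obtain \<sigma> where \<sigma>: "inj_on \<sigma> S" "\<forall>i\<in>S. \<sigma> i \<in> N i" by blast
    define M where "M i = N i - (\<Union>i\<in>S. N i)" for i
    have "\<exists>\<tau>. inj_on \<tau> (I - S) \<and> (\<forall>i\<in>I - S. \<tau> i \<in> M i)"
    proof (rule psubset.IH)
      show "I - S \<subset> I" using S by blast
      show "finite (M i)" if "i \<in> I - S" for i using fin that by (auto simp: M_def)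
      fix T assume T: "T \<subseteq> I - S"
      have fS: "finite S" and fT: "finite T"
        using S T psubset.hyps by (meson finite_subset psubset_imp_subset Diff_subset)+
      \<comment> \<open>The condition for \<open>T\<close> after the withdrawal is the condition for
        \<open>S \<union> T\<close> minus the equality for \<open>S\<close>.\<close>
      have "card S + card T = card (S \<union> T)"
        using T fS fT by (subst card_Un_disjoint) auto
      also have "\<dots> \<le> card (\<Union>i\<in>S \<union> T. N i)" using S T by (intro hall) auto
      also have "(\<Union>i\<in>S \<union> T. N i) = (\<Union>i\<in>S. N i) \<union> (\<Union>i\<in>T. M i)" by (auto simp: M_def)
      also have "card \<dots> \<le> card (\<Union>i\<in>S. N i) + card (\<Union>i\<in>T. M i)" by (rule card_Un_le)
      finally show "card T \<le> card (\<Union>i\<in>T. M i)" using S by simp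
    qed
    then obtain \<tau> where \<tau>: "inj_on \<tau> (I - S)" "\<forall>i\<in>I - S. \<tau> i \<in> M i" by blast
    define \<rho> where "\<rho> i = (if i \<in> S then \<sigma> i else \<tau> i)" for i
    have "\<rho> i = \<rho> k \<Longrightarrow> i \<in> S \<Longrightarrow> k \<in> I \<Longrightarrow> k \<in> S" for i k
      using \<sigma> \<tau> by (force simp: \<rho>_def M_def split: if_splits)
    then have "inj_on \<rho> I"
      using \<sigma>(1) \<tau>(1) by (smt (verit) DiffI \<rho>_def inj_on_def)
    moreover have "\<forall>i\<in>I. \<rho> i \<in> N i" using \<sigma> \<tau> by (auto simp: \<rho>_def M_def)
    ultimately show ?thesis by blast
  next
    case False
    show ?thesis
    proof (cases "I = {}")
      case nonempty: False
      then obtain k where k: "k \<in> I" by blast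
      have "card {k} \<le> card (\<Union>i\<in>{k}. N i)" using k by (intro hall) auto
      then obtain g where g: "g \<in> N k" by fastforce
      have "\<exists>\<tau>. inj_on \<tau> (I - {k}) \<and> (\<forall>i\<in>I - {k}. \<tau> i \<in> N i - {g})"
      proof (rule psubset.IH)
        show "I - {k} \<subset> I" using k by blast
        show "finite (N i - {g})" if "i \<in> I - {k}" for i using fin that by auto
        fix T assume T: "T \<subseteq> I - {k}"
        show "card T \<le> card (\<Union>i\<in>T. N i - {g})"
        proof (cases "T = {}")
          case False
          have "card (\<Union>i\<in>T. N i) \<noteq> card T"
            using \<open>\<nexists>S. _ S\<close> False T k by blast
          moreover have "card T \<le> card (\<Union>i\<in>T. N i)" using T by (intro hall) auto
          moreover have "(\<Union>i\<in>T. N i - {g}) = (\<Union>i\<in>T. N i) - {g}" by blast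
          moreover have "card (\<Union>i\<in>T. N i) - 1 \<le> card ((\<Union>i\<in>T. N i) - {g})"
            by (simp add: card_Diff_singleton_if)
          ultimately show ?thesis by simp
        qed simp
      qed
      then obtain \<tau> where \<tau>: "inj_on \<tau> (I - {k})" "\<forall>i\<in>I - {k}. \<tau> i \<in> N i - {g}" by blast
      have "inj_on (\<tau>(k := g)) I" using \<tau> by (auto simp: inj_on_def)
      moreover have "\<forall>i\<in>I. (\<tau>(k := g)) i \<in> N i" using \<tau> g by auto
      ultimately show ?thesis by blast
    qed simp
  qed
qed

text \<open>With integer prices a piece that is not optimal is at least one unit worse, so a unit
  price rise on all demanded pieces costs each agent of \<open>S\<close> a full unit. Strictness is
  the surplus that later pays for the removal of a piece.\<close>

lemma prices_with_surplus_demand: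
  fixes p :: "'i \<Rightarrow> 'g \<Rightarrow> int"
  assumes "finite I" "finite G" "card G = Suc (card I)"
  shows "\<exists>x. \<forall>S. S \<subseteq> I \<and> S \<noteq> {} \<longrightarrow>
    card S < card (\<Union>i\<in>S. {g \<in> G. \<forall>h\<in>G. p i h - x h \<le> p i g - x g})"
proof -
  have [simp]: "G \<noteq> {}" using assms by auto
  define u where "u x i = Max ((\<lambda>g. p i g - x g) ` G)" for x :: "'g \<Rightarrow> int" and i
  \<comment> \<open>A uniform shift of the prices changes \<open>f\<close> linearly; these weights
    make that change zero, as boundedness below requires.\<close>
  define f where "f x = int (card G) * (\<Sum>i\<in>I. u x i) + int (card I) * (\<Sum>g\<in>G. x g)" for x
  define D where "D x i = {g \<in> G. \<forall>h\<in>G. p i h - x h \<le> p i g - x g}" for x i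
  have u_ge: "p i g - x g \<le> u x i" if "g \<in> G" for x i g
    unfolding u_def using assms that by (intro Max_ge) auto
  have u_le: "u x i \<le> c" if "\<And>g. g \<in> G \<Longrightarrow> p i g - x g \<le> c" for x i c
    unfolding u_def using assms that by (subst Max_le_iff) auto
  have u_attained: "\<exists>g\<in>G. u x i = p i g - x g" for x i
    using Max_in[of "(\<lambda>g. p i g - x g) ` G"] assms unfolding u_def by fastforce
  have D_iff: "g \<in> D x i \<longleftrightarrow> g \<in> G \<and> p i g - x g = u x i" for x i g
    unfolding D_def using u_attained[of x i] u_ge[of _ i x] by (auto intro: antisym u_le)
  \<comment> \<open>A maximum is at least the average: \<open>card G * u x i\<close> dominates the
    sum over all pieces, and the price terms cancel.\<close>
  have f_ge: "(\<Sum>i\<in>I. \<Sum>g\<in>G. p i g) \<le> f x" for x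
  proof -
    have "(\<Sum>i\<in>I. (\<Sum>g\<in>G. p i g) - (\<Sum>g\<in>G. x g)) \<le> (\<Sum>i\<in>I. int (card G) * u x i)"
    proof (rule sum_mono)
      fix i
      have "(\<Sum>g\<in>G. p i g - x g) \<le> (\<Sum>g\<in>G. u x i)" by (intro sum_mono u_ge)
      then show "(\<Sum>g\<in>G. p i g) - (\<Sum>g\<in>G. x g) \<le> int (card G) * u x i"
        by (simp add: sum_subtractf)
    qed
    then show ?thesis by (simp add: f_def sum_subtractf sum_distrib_left)
  qed
  obtain x where x: "\<And>y. f x \<le> f y"
  proof -
    define b where "b = (\<Sum>i\<in>I. \<Sum>g\<in>G. p i g)"
    obtain x where "\<And>y. nat (f x - b) \<le> nat (f y - b)"
      using ex_has_least_nat[of "\<lambda>_. True" undefined "\<lambda>x. nat (f x - b)"] by auto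
    moreover have "b \<le> f y" for y using f_ge by (simp add: b_def)
    ultimately have "f x \<le> f y" for y by (smt (verit) nat_le_eq_zle)
    then show ?thesis using that by blast
  qed
  have "card S < card (\<Union>i\<in>S. D x i)" if S: "S \<subseteq> I" "S \<noteq> {}" for S
  proof -
    define T where "T = (\<Union>i\<in>S. D x i)"
    have T: "T \<subseteq> G" "finite T" and fS: "finite S" using S assms
      by (auto simp: T_def D_def intro: finite_subset)
    define y where "y g = x g + of_bool (g \<in> T)" for g
    have "u y i \<le> u x i - of_bool (i \<in> S)" for i
    proof (rule u_le)
      fix g assume g: "g \<in> G"
      show "p i g - y g \<le> u x i - of_bool (i \<in> S)"
      proof (cases "i \<in> S \<and> g \<notin> T")
        case True
        then have "p i g - x g \<noteq> u x i" using g by (auto simp: T_def D_iff)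
        then show ?thesis using u_ge[OF g, of i x] True by (auto simp: y_def)
      qed (use u_ge[OF g, of i x] in \<open>auto simp: y_def of_bool_def\<close>)
    qed
    then have "(\<Sum>i\<in>I. u y i) \<le> (\<Sum>i\<in>I. u x i - of_bool (i \<in> S))" by (intro sum_mono)
    also have "\<dots> = (\<Sum>i\<in>I. u x i) - int (card S)"
      using S assms(1) by (simp add: sum_subtractf of_bool_def sum.If_cases Int_absorb1 flip: sum.inter_filter)
    finally have "int (card G) * (\<Sum>i\<in>I. u y i) \<le> int (card G) * ((\<Sum>i\<in>I. u x i) - int (card S))"
      by (intro mult_left_mono) auto
    moreover have "(\<Sum>g\<in>G. y g) = (\<Sum>g\<in>G. x g) + int (card T)"
      using T assms(2) by (simp add: y_def sum.distrib of_bool_def sum.If_cases Int_absorb1)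
    ultimately have "int (card G) * int (card S) \<le> int (card I) * int (card T)"
      using x[of y] by (simp add: f_def algebra_simps)
    then have "card G * card S \<le> card I * card T" by (metis of_nat_le_iff of_nat_mult)
    moreover have "0 < card S" using S fS by (simp add: card_gt_0_iff)
    \<comment> \<open>As \<open>card G\<close> is one more than \<open>card I\<close>, the left side
      has \<open>card S > 0\<close> to spare.\<close>
    ultimately have "card I * card S < card I * card T"
      unfolding assms(3) mult_Suc by linarith
    then show ?thesis by (simp add: T_def)
  qed
  then show ?thesis unfolding D_def by blast
qed


section \<open>Rational values and the agent who is never asked\<close>

lemma common_denominator:
  fixes S :: "real set"
  assumes "finite S" "S \<subseteq> \<rat>"
  shows "\<exists>D::nat. D > 0 \<and> (\<forall>q\<in>S. q * D \<in> \<int>)"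
  using assms
proof (induction S)
  case empty
  then show ?case by auto
next
  case (insert q S)
  then obtain D :: nat where D: "D > 0" "\<forall>q\<in>S. q * D \<in> \<int>" by auto
  obtain a :: int and b :: nat where b: "b \<noteq> 0" "q = a / b"
    using insert.prems by (auto simp: Rats_eq_int_div_nat)
  have "q * real (b * D) = of_int (a * int D)" using b by simp
  then have "q * real (b * D) \<in> \<int>" by (metis Ints_of_int)
  moreover have "r * real (b * D) \<in> \<int>" if "r \<in> S" for r
  proof -
    have "r * real (b * D) = (r * D) * real b" by simp
    then show ?thesis using D that by (metis Ints_mult Ints_of_nat)
  qed
  ultimately show ?case using b D by (intro exI[of _ "b * D"]) auto
qed

lemma secretive_agent:
  fixes p :: "'i \<Rightarrow> 'g \<Rightarrow> real"
  assumes fin: "finite I" "finite G" and card: "card G = Suc (card I)"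
    and p: "\<And>i g. i \<in> I \<Longrightarrow> g \<in> G \<Longrightarrow> p i g \<in> \<rat> \<and> 0 \<le> p i g"
    and sum_p: "\<And>i. i \<in> I \<Longrightarrow> (\<Sum>g\<in>G. p i g) = 1"
  shows "\<exists>x. (\<forall>g\<in>G. 0 \<le> x g) \<and> (\<Sum>g\<in>G. x g) = 1 \<and>
    (\<forall>g\<in>G. \<exists>\<sigma>. inj_on \<sigma> I \<and> (\<forall>i\<in>I. \<sigma> i \<in> G - {g} \<and> x (\<sigma> i) \<le> p i (\<sigma> i)))"
proof -
  have "(\<lambda>(i, g). p i g) ` (I \<times> G) \<subseteq> \<rat>" using p by auto
  then obtain D :: nat where D: "D > 0" "\<And>i g. i \<in> I \<Longrightarrow> g \<in> G \<Longrightarrow> p i g * D \<in> \<int>"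
    using common_denominator[of "(\<lambda>(i, g). p i g) ` (I \<times> G)"] fin by auto
  define P where "P i g = \<lfloor>p i g * D\<rfloor>" for i g
  have P: "real_of_int (P i g) = p i g * D" if "i \<in> I" "g \<in> G" for i g
    using D(2)[OF that] by (simp add: P_def)
  define N where "N X i = {g \<in> G. \<forall>h\<in>G. P i h - X h \<le> P i g - X g}" for X i
  obtain X where X: "\<And>S. S \<subseteq> I \<Longrightarrow> S \<noteq> {} \<Longrightarrow> card S < card (\<Union>i\<in>S. N X i)"
    using prices_with_surplus_demand[OF fin card, of P] unfolding N_def by blast
  \<comment> \<open>The prices are shifted uniformly to total \<open>D\<close> and divided by
    \<open>D\<close>, so that they total 1 on the scale of \<open>p\<close>. Demand is
    unchanged.\<close>
  define z where "z g = (X g - ((\<Sum>h\<in>G. real_of_int (X h)) - D) / card G) / D" for g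
  have G0: "card G > 0" using card by simp
  have sum_z: "(\<Sum>g\<in>G. z g) = 1"
    using D(1) G0 by (simp add: z_def sum_subtractf flip: sum_divide_distrib)
  have z_le: "z g \<le> p i g" if i: "i \<in> I" and g: "g \<in> N X i" for i g
  proof -
    have "p i h - z h \<le> p i g - z g" if h: "h \<in> G" for h
    proof -
      have "real_of_int (P i h - X h) \<le> real_of_int (P i g - X g)"
        using g h unfolding N_def of_int_le_iff by blast
      then have "(p i h * D - X h) / D \<le> (p i g * D - X g) / D"
        using P[OF i h] P[OF i, of g] g D(1) by (intro divide_right_mono) (auto simp: N_def)
      then show ?thesis using D(1) by (simp add: z_def diff_divide_distrib)
    qed
    \<comment> \<open>Both \<open>p i\<close> and \<open>z\<close> total 1, so the differences add
      up to 0 and the largest of them is nonnegative.\<close>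
    then have "(\<Sum>h\<in>G. p i h - z h) \<le> (\<Sum>h\<in>G. p i g - z g)" by (intro sum_mono)
    then have "0 \<le> real (card G) * (p i g - z g)"
      by (simp add: sum_subtractf sum_p[OF i] sum_z)
    then show ?thesis using G0 by (simp add: zero_le_mult_iff)
  qed
  \<comment> \<open>Truncating negative prices and rescaling keeps \<open>x g \<le> p i g\<close>, because \<open>p i g \<ge> 0\<close>.\<close>
  define t where "t = (\<Sum>g\<in>G. max 0 (z g))"
  have t1: "1 \<le> t" unfolding t_def sum_z[symmetric] by (intro sum_mono) auto
  define x where "x g = max 0 (z g) / t" for g
  have x_le: "x g \<le> p i g" if "i \<in> I" "g \<in> N X i" for i g
  proof -
    have "x g \<le> max 0 (z g)" using t1 by (simp add: x_def divide_le_eq mult_le_cancel_left1)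
    also have "\<dots> \<le> p i g" using z_le[OF that] p that by (auto simp: N_def)
    finally show ?thesis .
  qed
  have "\<exists>\<sigma>. inj_on \<sigma> I \<and> (\<forall>i\<in>I. \<sigma> i \<in> N X i - {g})" if "g \<in> G" for g
  proof (rule hall_marriage)
    fix S assume S: "S \<subseteq> I"
    show "card S \<le> card (\<Union>i\<in>S. N X i - {g})"
    proof (cases "S = {}")
      case False
      have "(\<Union>i\<in>S. N X i - {g}) = (\<Union>i\<in>S. N X i) - {g}" by blast
      moreover have "card (\<Union>i\<in>S. N X i) - 1 \<le> card ((\<Union>i\<in>S. N X i) - {g})"
        by (simp add: card_Diff_singleton_if)
      ultimately show ?thesis using X[OF S False] by simp
    qed simp
  qed (use fin in \<open>auto simp: N_def\<close>)
  then have "\<exists>\<sigma>. inj_on \<sigma> I \<and> (\<forall>i\<in>I. \<sigma> i \<in> G - {g} \<and> x (\<sigma> i) \<le> p i (\<sigma> i))" if "g \<in> G" for g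
    using that x_le unfolding N_def by (smt (verit) Diff_iff mem_Collect_eq)
  moreover have "(\<Sum>g\<in>G. x g) = 1"
    using t1 by (simp add: x_def t_def flip: sum_divide_distrib)
  moreover have "\<forall>g\<in>G. 0 \<le> x g" using t1 by (simp add: x_def)
  ultimately show ?thesis by blast
qed

section \<open>Barycentric coordinates\<close>

definition bary_point :: "nat \<Rightarrow> (nat \<Rightarrow> 'a::euclidean_space) \<Rightarrow> (nat \<Rightarrow> real) \<Rightarrow> 'a" where
  "bary_point d v \<alpha> = (\<Sum>i=1..d. \<alpha> i *\<^sub>R v i)"

lemma regular_unit_simplex_independent:
  assumes reg: "regular_unit_simplex d v" and c: "(\<Sum>i=1..d. c i) = 0"
    and cv: "(\<Sum>i=1..d. c i *\<^sub>R v i) = 0" and j: "j \<in> {1..d}"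
  shows "c j = 0"
proof -
  \<comment> \<open>The combination \<open>\<Sum>i. c i * (dist (v i) (v k))\<^sup>2\<close> equals \<open>- c k\<close>, but does not depend on \<open>k\<close>.\<close>
  have const: "- c k = (\<Sum>i=1..d. c i * (v i \<bullet> v i))" if k: "k \<in> {1..d}" for k
  proof -
    have "(\<Sum>i=1..d. c i * (dist (v i) (v k))\<^sup>2) = (\<Sum>i=1..d. c i - (if i = k then c i else 0))"
      using reg k by (intro sum.cong) (auto simp: regular_unit_simplex_def)
    also have "\<dots> = - c k" using k c by (simp add: sum_subtractf)
    finally have "- c k = (\<Sum>i=1..d. c i * (dist (v i) (v k))\<^sup>2)" ..
    also have "\<dots> = (\<Sum>i=1..d. c i * (v i \<bullet> v i) - 2 * (c i *\<^sub>R v i \<bullet> v k) + c i * (v k \<bullet> v k))"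
      by (intro sum.cong) (auto simp: dist_norm power2_norm_eq_inner inner_diff inner_commute algebra_simps)
    also have "\<dots> = (\<Sum>i=1..d. c i * (v i \<bullet> v i)) - 2 * ((\<Sum>i=1..d. c i *\<^sub>R v i) \<bullet> v k)
        + (\<Sum>i=1..d. c i) * (v k \<bullet> v k)"
      by (simp only: sum.distrib sum_subtractf sum_distrib_left sum_distrib_right inner_sum_left)
    finally show ?thesis using c cv by simp
  qed
  have "c k = c j" if "k \<in> {1..d}" for k using const[OF that] const[OF j] by simp
  then have "(\<Sum>i=1..d. c i) = (\<Sum>i=1..d. c j)" by (intro sum.cong) auto
  then show ?thesis using c j by simp
qed

lemma bary_bary_point:
  assumes reg: "regular_unit_simplex d v" and \<alpha>: "(\<Sum>i=1..d. \<alpha> i) = 1" and j: "j \<in> {1..d}"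
  shows "bary d v (bary_point d v \<alpha>) j = \<alpha> j"
proof -
  define \<beta> where "\<beta> i = (if i \<in> {1..d} then \<alpha> i else 0)" for i
  have "bary d v (bary_point d v \<alpha>) = \<beta>"
    unfolding bary_def
  proof (rule the_equality)
    show "(\<forall>i. i \<notin> {1..d} \<longrightarrow> \<beta> i = 0) \<and> (\<Sum>i=1..d. \<beta> i) = 1 \<and>
        (\<Sum>i=1..d. \<beta> i *\<^sub>R v i) = bary_point d v \<alpha>"
      using \<alpha> by (simp add: \<beta>_def bary_point_def)
    fix \<gamma> assume \<gamma>: "(\<forall>i. i \<notin> {1..d} \<longrightarrow> \<gamma> i = 0) \<and> (\<Sum>i=1..d. \<gamma> i) = 1 \<and>
        (\<Sum>i=1..d. \<gamma> i *\<^sub>R v i) = bary_point d v \<alpha>"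
    have "\<gamma> i - \<alpha> i = 0" if "i \<in> {1..d}" for i
    proof (rule regular_unit_simplex_independent[OF reg _ _ that])
      show "(\<Sum>i=1..d. \<gamma> i - \<alpha> i) = 0" using \<gamma> \<alpha> unfolding sum_subtractf by simp
      show "(\<Sum>i=1..d. (\<gamma> i - \<alpha> i) *\<^sub>R v i) = 0"
        using \<gamma> unfolding scaleR_diff_left sum_subtractf bary_point_def by simp
    qed
    then show "\<gamma> = \<beta>" using \<gamma> by (auto simp: \<beta>_def fun_eq_iff)
  qed
  then show ?thesis using j by (simp add: \<beta>_def)
qed

lemma bary_point_in_simplex_of:
  assumes "\<And>i. i \<in> {1..d} \<Longrightarrow> 0 \<le> \<alpha> i" "(\<Sum>i=1..d. \<alpha> i) = 1"
  shows "bary_point d v \<alpha> \<in> simplex_of d v"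
  unfolding bary_point_def simplex_of_def
  by (rule convex_sum) (simp_all add: assms hull_inc convex_convex_hull del: One_nat_def)

lemma in_simplex_ofE:
  assumes reg: "regular_unit_simplex d v" and "x \<in> simplex_of d v"
  obtains "\<And>i. i \<in> {1..d} \<Longrightarrow> 0 \<le> bary d v x i" "(\<Sum>i=1..d. bary d v x i) = 1"
    "bary_point d v (bary d v x) = x"
proof -
  \<comment> \<open>Hull coefficients belong to points; injectivity turns them into coefficients of
    indices.\<close>
  have inj: "inj_on v {1..d}" using reg
    unfolding regular_unit_simplex_def inj_on_def by (metis dist_self zero_neq_one)
  obtain u where u: "\<forall>y\<in>v ` {1..d}. 0 \<le> u y" "sum u (v ` {1..d}) = 1"
      "(\<Sum>y\<in>v ` {1..d}. u y *\<^sub>R y) = x"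
    using assms(2) unfolding simplex_of_def by (auto simp: convex_hull_finite)
  define \<alpha> where "\<alpha> = u \<circ> v"
  have \<alpha>: "(\<Sum>i=1..d. \<alpha> i) = 1" "bary_point d v \<alpha> = x"
    using u(2,3) unfolding \<alpha>_def bary_point_def sum.reindex[OF inj] by (simp_all add: o_def)
  have eq: "bary d v x i = \<alpha> i" if "i \<in> {1..d}" for i
    using bary_bary_point[OF reg \<alpha>(1) that] \<alpha>(2) by simp
  show ?thesis
  proof (rule that)
    show "0 \<le> bary d v x i" if "i \<in> {1..d}" for i using u eq[OF that] that by (auto simp: \<alpha>_def)
    show "(\<Sum>i=1..d. bary d v x i) = 1" using \<alpha> eq by simp
    show "bary_point d v (bary d v x) = x" using \<alpha>(2) eq by (simp add: bary_point_def)
  qed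
qed

section \<open>Half-space preferences as coordinate thresholds\<close>

text \<open>The linear form \<open>a \<bullet> x\<close> is constant on the facet opposite
  \<open>v j\<close>, so on the simplex it is an affine function of the \<open>j\<close>-th
  coordinate alone, and a bound on it is a bound on that coordinate.\<close>

lemma half_space_preferences_threshold:
  assumes d: "d \<ge> 2" and reg: "regular_unit_simplex d v"
    and half: "half_space_preferences d v A" and i: "i \<in> {1..d}" and j: "j \<in> {1..d}"
  shows "\<exists>t\<ge>0. A i j = {x \<in> simplex_of d v. bary d v x j \<le> t}"
proof -
  obtain a b where par: "affine_parallel {x. a \<bullet> x = b} (affine hull (facet d v j))"
    and A: "A i j = simplex_of d v \<inter> {x. a \<bullet> x \<le> b}" and F: "facet d v j \<subseteq> A i j"
    using half i j unfolding half_space_preferences_def by metis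
  obtain c where c: "affine hull (facet d v j) = (\<lambda>x. c + x) ` {x. a \<bullet> x = b}"
    using par unfolding affine_parallel_def by blast
  \<comment> \<open>\<open>c\<close> translates the boundary hyperplane onto the hull of the facet,
    so this is the value of the form there.\<close>
  define \<beta> where "\<beta> = a \<bullet> c + b"
  have vF: "v k \<in> facet d v j" if "k \<in> {1..d}" "k \<noteq> j" for k
    using that unfolding facet_def by (auto intro: hull_inc)
  have v\<beta>: "a \<bullet> v k = \<beta>" if "k \<in> {1..d}" "k \<noteq> j" for k
  proof -
    have "v k \<in> affine hull (facet d v j)" using vF[OF that] by (rule hull_inc)
    then show ?thesis unfolding c by (auto simp: \<beta>_def inner_right_distrib)
  qed
  \<comment> \<open>Some vertex of the facet, available because \<open>d \<ge> 2\<close>. It lies in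
    \<open>A i j\<close>, whence \<open>\<beta> \<le> b\<close> and a nonnegative threshold.\<close>
  define k where "k = (if j = 1 then 2 else 1 :: nat)"
  have k: "k \<in> {1..d}" "k \<noteq> j" using d by (auto simp: k_def)
  have \<beta>b: "\<beta> \<le> b" using vF[OF k] F A v\<beta>[OF k] by auto
  define \<gamma> where "\<gamma> = a \<bullet> v j - \<beta>"
  have ax: "a \<bullet> x = \<beta> + bary d v x j * \<gamma>" and le1: "bary d v x j \<le> 1" and ge0: "0 \<le> bary d v x j"
    if x: "x \<in> simplex_of d v" for x
  proof -
    from reg x show "a \<bullet> x = \<beta> + bary d v x j * \<gamma>"
    proof (rule in_simplex_ofE)
      assume *: "(\<Sum>i=1..d. bary d v x i) = 1" "bary_point d v (bary d v x) = x"
      have "a \<bullet> x = a \<bullet> bary_point d v (bary d v x)" by (simp only: *(2))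
      also have "\<dots> = (\<Sum>i=1..d. bary d v x i * (a \<bullet> v i))"
        by (simp add: bary_point_def inner_sum_right)
      also have "\<dots> = (\<Sum>i=1..d. bary d v x i * \<beta> + (if i = j then bary d v x i * \<gamma> else 0))"
        using v\<beta> by (intro sum.cong) (auto simp: \<gamma>_def algebra_simps)
      also have "\<dots> = \<beta> + bary d v x j * \<gamma>"
        using j *(1) by (simp add: sum.distrib flip: sum_distrib_right)
      finally show ?thesis .
    qed
    from reg x show "bary d v x j \<le> 1"
    proof (rule in_simplex_ofE)
      assume "\<And>i. i \<in> {1..d} \<Longrightarrow> 0 \<le> bary d v x i" "(\<Sum>i=1..d. bary d v x i) = 1"
      then show ?thesis using member_le_sum[of j "{1..d}" "bary d v x"] j by auto
    qed
    from reg x show "0 \<le> bary d v x j" by (rule in_simplex_ofE) (use j in auto)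
  qed
  show ?thesis
  proof (cases "\<gamma> > 0")
    case True
    have "A i j = {x \<in> simplex_of d v. bary d v x j \<le> (b - \<beta>) / \<gamma>}"
      unfolding A using True by (auto simp: ax pos_le_divide_eq algebra_simps)
    then show ?thesis using True \<beta>b by (intro exI[of _ "(b - \<beta>) / \<gamma>"]) auto
  next
    case False
    \<comment> \<open>The form does not increase away from the facet, so the whole simplex is
      accepted; 1 bounds every coordinate.\<close>
    have "a \<bullet> x \<le> b" if "x \<in> simplex_of d v" for x
      using ax[OF that] ge0[OF that] False \<beta>b by (smt (verit) mult_nonneg_nonpos)
    then have "A i j = {x \<in> simplex_of d v. bary d v x j \<le> 1}"
      unfolding A using le1 by auto
    then show ?thesis by (intro exI[of _ 1]) auto
  qed
qed

lemma in_nbhdI: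
  assumes "y \<in> S" and "\<And>k. k \<in> {1..d} \<Longrightarrow> \<bar>bary d v x k - bary d v y k\<bar> \<le> \<epsilon>" and "d \<ge> 1"
  shows "x \<in> nbhd d v \<epsilon> S"
proof -
  have "0 \<le> bary_dist d v x z" for z
    unfolding bary_dist_def using \<open>d \<ge> 1\<close> by (intro Max_ge_iff[THEN iffD2]) auto
  then have "(INF y\<in>S. bary_dist d v x y) \<le> bary_dist d v x y"
    using \<open>y \<in> S\<close> by (intro cINF_lower bdd_belowI2[of _ 0]) auto
  also have "\<dots> \<le> \<epsilon>"
    unfolding bary_dist_def using assms by (intro Max.boundedI) auto
  finally show ?thesis using \<open>y \<in> S\<close> by (auto simp: nbhd_def)
qed

text \<open>The excess over \<open>t\<close> is moved from coordinate \<open>j\<close> to another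
  coordinate \<open>k\<close>. The new point stays in the simplex, and no coordinate changes by more
  than \<open>\<epsilon>\<close>.\<close>

lemma threshold_in_nbhd:
  assumes d: "d \<ge> 2" and reg: "regular_unit_simplex d v" and x: "x \<in> simplex_of d v"
    and j: "j \<in> {1..d}" and t: "0 \<le> t" and \<epsilon>: "0 \<le> \<epsilon>" "bary d v x j \<le> t + \<epsilon>"
  shows "x \<in> nbhd d v \<epsilon> {y \<in> simplex_of d v. bary d v y j \<le> t}"
proof (cases "bary d v x j \<le> t")
  case True
  then show ?thesis using x d \<epsilon> by (intro in_nbhdI[of x]) auto
next
  case False
  define k where "k = (if j = 1 then 2 else 1 :: nat)"
  have k: "k \<in> {1..d}" "k \<noteq> j" using d by (auto simp: k_def)
  define \<delta> where "\<delta> = bary d v x j - t"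
  define \<alpha> where "\<alpha> i = bary d v x i + (if i = k then \<delta> else 0) - (if i = j then \<delta> else 0)" for i
  from reg x show ?thesis
  proof (rule in_simplex_ofE)
    assume ge0: "\<And>i. i \<in> {1..d} \<Longrightarrow> 0 \<le> bary d v x i" and sum1: "(\<Sum>i=1..d. bary d v x i) = 1"
    have sum_\<alpha>: "(\<Sum>i=1..d. \<alpha> i) = 1"
      using j k sum1 by (simp add: \<alpha>_def sum.distrib sum_subtractf)
    have "0 \<le> \<alpha> i" if "i \<in> {1..d}" for i
      using ge0[OF that] t False k by (auto simp: \<alpha>_def \<delta>_def)
    then have "bary_point d v \<alpha> \<in> simplex_of d v" using sum_\<alpha> by (rule bary_point_in_simplex_of)
    moreover have "\<alpha> j = t" using k by (simp add: \<alpha>_def \<delta>_def)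
    ultimately show ?thesis
      using j k d \<epsilon> False
      by (intro in_nbhdI[of "bary_point d v \<alpha>"])
         (auto simp: bary_bary_point[OF reg sum_\<alpha>] \<alpha>_def \<delta>_def)
  qed
qed


section \<open>The search\<close>

definition slack :: "nat \<Rightarrow> (nat \<Rightarrow> real) \<Rightarrow> real" where
  "slack d a = 1 - (\<Sum>j=1..d. a j)"

definition raised :: "nat \<Rightarrow> (nat \<Rightarrow> real) \<Rightarrow> nat \<Rightarrow> real" where
  "raised d a j = a j + slack d a / d"

text \<open>\<open>g\<close> stands for the piece that agent \<open>d\<close> will take. The others
  are matched through their next query points, since the true thresholds are not known when the
  output is chosen.\<close>

definition secretive_fair ::
    "nat \<Rightarrow> (nat \<Rightarrow> 'a::euclidean_space) \<Rightarrow> (nat \<Rightarrow> nat \<Rightarrow> real) \<Rightarrow> 'a \<Rightarrow> bool" where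
  "secretive_fair d v l y \<longleftrightarrow> y \<in> simplex_of d v \<and>
     (\<forall>g\<in>{1..d}. \<exists>\<sigma>. inj_on \<sigma> {1..<d} \<and>
        (\<forall>i\<in>{1..<d}. \<sigma> i \<in> {1..d} - {g} \<and> bary d v y (\<sigma> i) \<le> raised d (l i) (\<sigma> i)))"

text \<open>The list fixes in advance whom to ask; only the points adapt to the answers. The output
  is chosen from the bounds \<open>l\<close> alone, which record the answers.\<close>

primrec search ::
    "nat \<Rightarrow> (nat \<Rightarrow> 'a::euclidean_space) \<Rightarrow> nat list \<Rightarrow> (nat \<Rightarrow> nat \<Rightarrow> real) \<Rightarrow> 'a algorithm" where
  "search d v [] l = Output (SOME y. secretive_fair d v l y)"
| "search d v (i # is) l = Query i (bary_point d v (raised d (l i)))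
     (\<lambda>j. search d v is (l(i := (l i)(j := raised d (l i) j))))"

text \<open>The part of the invariant that does not mention the preference sets, so that validity of
  the tree can be proved without them. Rationality is what \<open>secretive_agent\<close> asks
  for.\<close>

definition lower_bounds :: "nat \<Rightarrow> (nat \<Rightarrow> nat \<Rightarrow> real) \<Rightarrow> bool" where
  "lower_bounds d l \<longleftrightarrow>
     (\<forall>i\<in>{1..d}. 0 \<le> slack d (l i) \<and> (\<forall>j\<in>{1..d}. 0 \<le> l i j \<and> l i j \<in> \<rat>))"

lemma sum_raised: "d \<ge> 1 \<Longrightarrow> (\<Sum>j=1..d. raised d a j) = 1"
  by (simp add: raised_def sum.distrib slack_def)

lemma slack_raise:
  assumes "j \<in> {1..d}"
  shows "slack d (a(j := raised d a j)) = slack d a * (1 - 1 / d)"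
proof -
  have "(\<Sum>k=1..d. (a(j := raised d a j)) k) = (\<Sum>k=1..d. a k + (if k = j then slack d a / d else 0))"
    by (intro sum.cong) (auto simp: raised_def)
  also have "\<dots> = (\<Sum>k=1..d. a k) + slack d a / d" using assms by (simp add: sum.distrib)
  finally show ?thesis by (simp add: slack_def diff_divide_distrib algebra_simps)
qed

lemma raised_nonneg_Rats:
  assumes "lower_bounds d l" "i \<in> {1..d}" "j \<in> {1..d}"
  shows "0 \<le> raised d (l i) j" "raised d (l i) j \<in> \<rat>"
proof -
  have "slack d (l i) \<in> \<rat>"
    unfolding slack_def using assms
    by (intro Rats_diff Rats_1 Rats_sum) (auto simp: lower_bounds_def)
  then show "raised d (l i) j \<in> \<rat>"
    unfolding raised_def using assms by (intro Rats_add Rats_divide) (auto simp: lower_bounds_def)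
  show "0 \<le> raised d (l i) j" using assms by (auto simp: raised_def lower_bounds_def)
qed

lemma lower_bounds_raise:
  assumes "lower_bounds d l" "i \<in> {1..d}" "j \<in> {1..d}"
  shows "lower_bounds d (l(i := (l i)(j := raised d (l i) j)))"
proof -
  have "0 \<le> slack d (l i) * (1 - 1 / d)"
    using assms by (intro mult_nonneg_nonneg) (auto simp: lower_bounds_def)
  then show ?thesis
    using assms raised_nonneg_Rats[OF assms] by (auto simp: lower_bounds_def slack_raise)
qed

lemma secretive_fair_exists:
  assumes d: "d \<ge> 1" and reg: "regular_unit_simplex d v" and l: "lower_bounds d l"
  shows "\<exists>y. secretive_fair d v l y"
proof -
  have "\<exists>x. (\<forall>g\<in>{1..d}. 0 \<le> x g) \<and> (\<Sum>g=1..d. x g) = 1 \<and>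
    (\<forall>g\<in>{1..d}. \<exists>\<sigma>. inj_on \<sigma> {1..<d} \<and>
      (\<forall>i\<in>{1..<d}. \<sigma> i \<in> {1..d} - {g} \<and> x (\<sigma> i) \<le> raised d (l i) (\<sigma> i)))"
    by (rule secretive_agent) (use d sum_raised raised_nonneg_Rats[OF l] in auto)
  then obtain x where x: "\<forall>g\<in>{1..d}. 0 \<le> x g" "(\<Sum>g=1..d. x g) = 1"
    "\<forall>g\<in>{1..d}. \<exists>\<sigma>. inj_on \<sigma> {1..<d} \<and>
      (\<forall>i\<in>{1..<d}. \<sigma> i \<in> {1..d} - {g} \<and> x (\<sigma> i) \<le> raised d (l i) (\<sigma> i))"
    by blast
  have "bary_point d v x \<in> simplex_of d v" using x by (intro bary_point_in_simplex_of) auto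
  moreover have "\<forall>k\<in>{1..d}. bary d v (bary_point d v x) k = x k"
    using bary_bary_point[OF reg x(2)] by blast
  ultimately have "secretive_fair d v l (bary_point d v x)"
    unfolding secretive_fair_def using x(3) by (metis Diff_iff)
  then show ?thesis ..
qed

lemma valid_search:
  assumes d: "d \<ge> 1" and reg: "regular_unit_simplex d v"
  shows "lower_bounds d l \<Longrightarrow> set is \<subseteq> {1..d} \<Longrightarrow> valid_algorithm d v (search d v is l)"
proof (induction "is" arbitrary: l)
  case Nil
  have "secretive_fair d v l (SOME y. secretive_fair d v l y)"
    by (rule someI_ex[OF secretive_fair_exists[OF d reg Nil.prems(1)]])
  then show ?case by (simp add: secretive_fair_def)
next
  case (Cons i "is")
  have "bary_point d v (raised d (l i)) \<in> simplex_of d v"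
    using Cons.prems d by (intro bary_point_in_simplex_of raised_nonneg_Rats sum_raised) auto
  moreover have "valid_algorithm d v (search d v is (l(i := (l i)(j := raised d (l i) j))))"
    if "j \<in> {1..d}" for j
    using Cons.prems that by (intro Cons.IH lower_bounds_raise) auto
  ultimately show ?case using Cons.prems by simp
qed

text \<open>\<open>l'\<close> is the table of bounds from which the output was chosen. Each query to
  an agent multiplies that agent's slack, and no other, by the same factor whatever the answer;
  hence the exponent.\<close>

lemma minimal_run_search:
  assumes d: "d \<ge> 1" and reg: "regular_unit_simplex d v"
    and A: "\<And>i j. i \<in> {1..d} \<Longrightarrow> j \<in> {1..d} \<Longrightarrow> A i j = {x \<in> simplex_of d v. bary d v x j \<le> t i j}"
  shows "minimal_run d A (search d v is l) y k \<Longrightarrow> lower_bounds d l \<Longrightarrow> set is \<subseteq> {1..d} \<Longrightarrow>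
    (\<And>i j. i \<in> {1..d} \<Longrightarrow> j \<in> {1..d} \<Longrightarrow> l i j \<le> t i j) \<Longrightarrow>
    k = length is \<and> (\<exists>l'. secretive_fair d v l' y \<and>
      (\<forall>i\<in>{1..d}. slack d (l' i) = slack d (l i) * (1 - 1 / d) ^ count_list is i \<and>
        (\<forall>j\<in>{1..d}. l' i j \<le> t i j)))"
proof (induction "is" arbitrary: l k)
  case Nil
  have "secretive_fair d v l (SOME y. secretive_fair d v l y)"
    by (rule someI_ex[OF secretive_fair_exists[OF d reg Nil.prems(2)]])
  moreover from Nil.prems(1) have "y = (SOME y. secretive_fair d v l y)" "k = 0"
    by (auto elim: minimal_run.cases)
  ultimately show ?case using Nil.prems(4) by (auto intro!: exI[of _ l])
next
  case (Cons i "is")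
  define a where "a = raised d (l i)"
  obtain j k' where run: "j \<in> {1..d}" "bary_point d v a \<in> A i j" "k = Suc k'"
    "minimal_run d A (search d v is (l(i := (l i)(j := a j)))) y k'"
    using Cons.prems(1) by (cases rule: minimal_run.cases) (auto simp: a_def)
  have i: "i \<in> {1..d}" using Cons.prems by auto
  \<comment> \<open>The answer \<open>j\<close> places the queried point in \<open>A i j\<close>, so
    its \<open>j\<close>-th coordinate is again a valid lower bound for
    \<open>t i j\<close>.\<close>
  have "a j = bary d v (bary_point d v a) j"
    using bary_bary_point[OF reg] sum_raised[OF d] run(1) by (simp add: a_def)
  also have "\<dots> \<le> t i j" using run A[OF i run(1)] by auto
  finally have aj: "a j \<le> t i j" .
  have "k' = length is \<and> (\<exists>l'. secretive_fair d v l' y \<and>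
      (\<forall>m\<in>{1..d}. slack d (l' m) = slack d ((l(i := (l i)(j := a j))) m) * (1 - 1 / d) ^ count_list is m \<and>
        (\<forall>j\<in>{1..d}. l' m j \<le> t m j)))"
  proof (rule Cons.IH[OF run(4)])
    show "lower_bounds d (l(i := (l i)(j := a j)))"
      unfolding a_def by (rule lower_bounds_raise[OF Cons.prems(2) i run(1)])
    show "set is \<subseteq> {1..d}" using Cons.prems(3) by simp
    show "(l(i := (l i)(j := a j))) m g \<le> t m g" if "m \<in> {1..d}" "g \<in> {1..d}" for m g
      using Cons.prems(4)[OF that] aj by auto
  qed
  moreover have "slack d ((l(i := (l i)(j := a j))) m) * (1 - 1 / d) ^ count_list is m
      = slack d (l m) * (1 - 1 / d) ^ count_list (i # is) m" for m
    by (cases "m = i") (simp_all add: a_def slack_raise[OF run(1)] mult.assoc)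
  ultimately show ?case by (simp only: run(3) length_Cons)
qed

section \<open>Correctness and query count\<close>

lemma count_list_concat_replicate:
  "count_list (concat (map (replicate K) xs)) i = K * count_list xs i"
proof (induction xs)
  case (Cons x xs)
  have "count_list (replicate K x) i = (if x = i then K else 0)" by (induction K) auto
  then show ?case using Cons by simp
qed simp

text \<open>Agent \<open>d\<close> accepts some piece \<open>g\<close> at \<open>y\<close> because
  the sets cover the simplex. The matching that avoids \<open>g\<close> then completes to a
  permutation.\<close>

lemma secretive_fair_imp_fair:
  assumes d: "d \<ge> 2" and reg: "regular_unit_simplex d v" and pref: "preference_sets d v A"
    and A: "\<And>i j. i \<in> {1..d} \<Longrightarrow> j \<in> {1..d} \<Longrightarrow> A i j = {x \<in> simplex_of d v. bary d v x j \<le> t i j}"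
    and t: "\<And>i j. i \<in> {1..d} \<Longrightarrow> j \<in> {1..d} \<Longrightarrow> 0 \<le> t i j"
    and fair: "secretive_fair d v l y" and \<epsilon>: "0 \<le> \<epsilon>"
    and l: "\<And>i j. i \<in> {1..<d} \<Longrightarrow> j \<in> {1..d} \<Longrightarrow> raised d (l i) j \<le> t i j + \<epsilon>"
  shows "fair_division_point d v \<epsilon> A y"
proof -
  have y: "y \<in> simplex_of d v" using fair by (simp add: secretive_fair_def)
  have near: "y \<in> nbhd d v \<epsilon> (A i j)"
    if "i \<in> {1..d}" "j \<in> {1..d}" "bary d v y j \<le> t i j + \<epsilon>" for i j
    unfolding A[OF that(1,2)] using d reg y that t[OF that(1,2)] \<epsilon> by (intro threshold_in_nbhd)
  have "d \<in> {1..d}" using d by simp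
  then obtain g where g: "g \<in> {1..d}" "y \<in> A d g" using pref y unfolding preference_sets_def by blast
  obtain \<sigma> where \<sigma>: "inj_on \<sigma> {1..<d}"
    "\<forall>i\<in>{1..<d}. \<sigma> i \<in> {1..d} - {g} \<and> bary d v y (\<sigma> i) \<le> raised d (l i) (\<sigma> i)"
    using fair g(1) unfolding secretive_fair_def by blast
  \<comment> \<open>The last case is the identity, as \<open>permutes\<close> demands outside
    \<open>{1..d}\<close>.\<close>
  define \<pi> where "\<pi> i = (if i = d then g else if i \<in> {1..<d} then \<sigma> i else i)" for i
  have inj: "inj_on \<pi> {1..d}"
    using \<sigma> by (auto simp: inj_on_def \<pi>_def)
  have \<pi>: "\<pi> i \<in> {1..d}" if "i \<in> {1..d}" for i
    using \<sigma>(2) g(1) that unfolding \<pi>_def by auto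
  have "\<pi> ` {1..d} = {1..d}" using \<pi> inj by (intro endo_inj_surj) auto
  then have "\<pi> permutes {1..d}"
    using inj d by (intro bij_imp_permutes) (auto simp: bij_betw_def \<pi>_def)
  moreover have "y \<in> nbhd d v \<epsilon> (A i (\<pi> i))" if i: "i \<in> {1..d}" for i
  proof (rule near[OF i \<pi>[OF i]])
    show "bary d v y (\<pi> i) \<le> t i (\<pi> i) + \<epsilon>"
    proof (cases "i = d")
      case True
      then show ?thesis using g A[of d g] i \<epsilon> by (auto simp: \<pi>_def)
    next
      case False
      then have "i \<in> {1..<d}" using i by auto
      moreover from this have "\<pi> i = \<sigma> i" by (simp add: \<pi>_def)
      ultimately show ?thesis using \<sigma>(2) l[of i "\<sigma> i"] by fastforce
    qed
  qed
  ultimately show ?thesis using y unfolding fair_division_point_def by blast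
qed

theorem theorem4p4:
  fixes d :: nat and \<epsilon> :: real and n :: int and v :: "nat \<Rightarrow> 'a::euclidean_space"
  assumes "d \<ge> 2" and "\<epsilon> > 0" and "n = \<lceil>1 / \<epsilon>\<rceil>"
    and "DIM('a) = d - 1" and "regular_unit_simplex d v"
  shows "\<exists>T. valid_algorithm d v T \<and>
    (\<forall>A. preference_sets d v A \<and> half_space_preferences d v A \<longrightarrow>
      (\<forall>y k. minimal_run d A T y k \<longrightarrow>
        int k \<le> (int d - 1) * \<lceil>log (real d / (real d - 1)) (real_of_int n)\<rceil> \<and>
        fair_division_point d v \<epsilon> A y))"
proof -
  note d = assms(1) and \<epsilon> = assms(2) and reg = assms(5)
  define q where "q = real d / (real d - 1)"
  have q: "q > 1" using d by (simp add: q_def)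
  have n: "1 / \<epsilon> \<le> real_of_int n" "1 \<le> n"
    using \<epsilon> assms(3) by auto
  define K where "K = nat \<lceil>log q n\<rceil>"
  \<comment> \<open>Thus the conversion by \<open>nat\<close> in \<open>K\<close> does not
    truncate.\<close>
  have "0 \<le> log q n" using q n by simp
  then have K: "int K = \<lceil>log q n\<rceil>" by (simp add: K_def)
  have "real_of_int n = q powr log q n" using q n by simp
  also have "\<dots> \<le> q powr real K" using q K by (intro powr_mono) linarith+
  also have "\<dots> = q ^ K" using q by (simp add: powr_realpow)
  finally have "1 / \<epsilon> \<le> q ^ K" using n by linarith
  then have "1 / q ^ K \<le> \<epsilon>" using \<epsilon> q by (simp add: divide_le_eq mult.commute)
  moreover have "1 - 1 / d = 1 / q" using d by (simp add: q_def field_simps)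
  ultimately have shrink: "(1 - 1 / d) ^ K \<le> \<epsilon>" by (simp add: power_one_over)
  \<comment> \<open>Agents \<open>1\<close> to \<open>d - 1\<close> are each asked \<open>K\<close>
    times, and agent \<open>d\<close> never.\<close>
  define "is" where "is = concat (map (replicate K) [1..<d])"
  have len: "length is = (d - 1) * K" by (simp add: is_def length_concat comp_def sum_list_triv)
  have set: "set is \<subseteq> {1..d}" by (auto simp: is_def)
  have count: "count_list is i = K" if "i \<in> {1..<d}" for i
  proof -
    have "count_list [1..<d] i = 1" using that
      by (simp add: count_mset[symmetric] distinct_count_atmost_1)
    then show ?thesis by (simp add: is_def count_list_concat_replicate)
  qed
  \<comment> \<open>Zero is below every threshold, and the initial slack is 1, so the final slack of
    an agent is a pure power of \<open>1 - 1 / d\<close>.\<close>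
  define l0 :: "nat \<Rightarrow> nat \<Rightarrow> real" where "l0 = (\<lambda>i j. 0)"
  have l0: "lower_bounds d l0" by (simp add: lower_bounds_def l0_def slack_def)
  have "int k \<le> (int d - 1) * \<lceil>log q n\<rceil> \<and> fair_division_point d v \<epsilon> A y"
    if pref: "preference_sets d v A" and half: "half_space_preferences d v A"
      and run: "minimal_run d A (search d v is l0) y k" for A y k
  proof -
    have "\<forall>i j. \<exists>t. i \<in> {1..d} \<longrightarrow> j \<in> {1..d} \<longrightarrow>
        0 \<le> t \<and> A i j = {x \<in> simplex_of d v. bary d v x j \<le> t}"
      using half_space_preferences_threshold[OF d reg half] by blast
    then obtain t where t: "\<And>i j. i \<in> {1..d} \<Longrightarrow> j \<in> {1..d} \<Longrightarrow> 0 \<le> t i j"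
      and A: "\<And>i j. i \<in> {1..d} \<Longrightarrow> j \<in> {1..d} \<Longrightarrow> A i j = {x \<in> simplex_of d v. bary d v x j \<le> t i j}"
      by metis
    have "k = length is \<and> (\<exists>l'. secretive_fair d v l' y \<and>
      (\<forall>i\<in>{1..d}. slack d (l' i) = slack d (l0 i) * (1 - 1 / d) ^ count_list is i \<and>
        (\<forall>j\<in>{1..d}. l' i j \<le> t i j)))"
      using d t by (intro minimal_run_search[OF _ reg A run l0 set]) (auto simp: l0_def)
    then obtain l where k: "k = length is" and fair: "secretive_fair d v l y"
      and sl: "\<And>i. i \<in> {1..d} \<Longrightarrow> slack d (l i) = (1 - 1 / d) ^ count_list is i"
      and lt: "\<And>i j. i \<in> {1..d} \<Longrightarrow> j \<in> {1..d} \<Longrightarrow> l i j \<le> t i j"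
      by (auto simp: l0_def slack_def)
    have "raised d (l i) j \<le> t i j + \<epsilon>" if i: "i \<in> {1..<d}" and j: "j \<in> {1..d}" for i j
    proof -
      have "slack d (l i) \<le> \<epsilon>" using sl[of i] count[OF i] i shrink by simp
      \<comment> \<open>This share is all that separates the next query point from the proven bounds
        in each coordinate.\<close>
      then have "slack d (l i) / d \<le> \<epsilon>" using d \<epsilon>
        by (smt (verit) divide_le_eq mult_le_cancel_left1 of_nat_1 of_nat_le_iff one_le_numeral order_trans)
      then show ?thesis using lt[of i j] i j by (simp add: raised_def)
    qed
    then have "fair_division_point d v \<epsilon> A y"
      using \<epsilon> by (intro secretive_fair_imp_fair[OF d reg pref A t fair]) auto
    moreover have "int k = (int d - 1) * \<lceil>log q n\<rceil>" using d k len K by (simp add: of_nat_diff)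
    ultimately show ?thesis by simp
  qed
  moreover have "valid_algorithm d v (search d v is l0)" using d reg l0 set by (intro valid_search) auto
  ultimately show ?thesis unfolding q_def by blast
qed

end
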